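(* Let $\Gamma$ be a log-space computable function from finite digraphs to finite digraphs that has a right adjoint $\Omega$ and a log-space computable left adjoint $\Lambda$. Then $\mathrm{PCSP}(\Gamma\mathbf H,\mathbf G)$ and $\mathrm{PCSP}(\mathbf H,\Omega\mathbf G)$ are log-space equivalent (each log-space reduces to the other) for all finite digraphs $\mathbf H,\mathbf G$ such that $\Gamma\mathbf H\to\mathbf G$.
   Context: Digraphs may have loops. A homomorphism $\mathbf H\to\mathbf G$ is a map $V(H)\to V(G)$ sending arcs to arcs; $\mathbf H\to\mathbf G$ means one exists. Functions $\Lambda,\Gamma$ from finite digraphs to finite digraphs are adjoint ($\Lambda$ is the left adjoint of $\Gamma$, $\Gamma$ the right adjoint of $\Lambda$) if for all finite digraphs $\mathbf H,\mathbf G$: $\Lambda\mathbf H\to\mathbf G$ iff $\mathbf H\to\Gamma\mathbf G$. Thus here $\Lambda\mathbf H\to\mathbf G\iff\mathbf H\to\Gamma\mathbf G$ and $\Gamma\mathbf H\to\mathbf G\iff\mathbf H\to\Omega\mathbf G$. For digraphs $\mathbf A\to\mathbf B$, $\mathrm{PCSP}(\mathbf A,\mathbf B)$ is the promise decision problem: given a finite digraph $\mathbf I$ with either $\mathbf I\to\mathbf A$ or $\mathbf I\not\to\mathbf B$, output YES in the former case and NO in the latter. *)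

theory Defs
  imports "Graph_Theory.Pair_Digraph" "HOL-Library.Landau_Symbols"
begin

section \<open>Finite digraphs and homomorphisms\<close>

text \<open>
  Finite digraphs are the library's \<^const>\<open>pair_fin_digraph\<close>s: loops are allowed, parallel arcs
  are not, and the vertex set may be empty. The vertices are natural numbers, so that the finite
  digraphs form a single type, which covers every finite digraph up to isomorphism, and can be
  written down as strings.
\<close>

type_synonym digraph = "nat pair_pre_digraph"

definition digraph_hom :: "('a \<Rightarrow> 'b) \<Rightarrow> 'a pair_pre_digraph \<Rightarrow> 'b pair_pre_digraph \<Rightarrow> bool" where
  "digraph_hom h H G \<longleftrightarrow>
     (\<forall>v \<in> pverts H. h v \<in> pverts G) \<and> (\<forall>(u, v) \<in> parcs H. (h u, h v) \<in> parcs G)"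

definition hom_to :: "'a pair_pre_digraph \<Rightarrow> 'b pair_pre_digraph \<Rightarrow> bool" (infix "\<leadsto>" 50) where
  "H \<leadsto> G \<longleftrightarrow> (\<exists>h. digraph_hom h H G)"

definition fin_digraph_map :: "(digraph \<Rightarrow> digraph) \<Rightarrow> bool" where
  "fin_digraph_map F \<longleftrightarrow> (\<forall>G. pair_fin_digraph G \<longrightarrow> pair_fin_digraph (F G))"

definition adjoint :: "(digraph \<Rightarrow> digraph) \<Rightarrow> (digraph \<Rightarrow> digraph) \<Rightarrow> bool" where
  "adjoint L R \<longleftrightarrow>
     (\<forall>H G. pair_fin_digraph H \<longrightarrow> pair_fin_digraph G \<longrightarrow> (L H \<leadsto> G \<longleftrightarrow> H \<leadsto> R G))"


section \<open>Turing machines with a read-only input tape and a write-only output tape\<close>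

datatype move = Left | Stay | Right

datatype 'a input_cell = LeftEnd | Letter 'a | RightEnd

text \<open>
  The states are \<open>0, \<dots>, num_states - 1\<close> and the work tape symbols are \<open>0, \<dots>, num_symbols - 1\<close>,
  where 0 is the blank. A transition is determined by the state, the scanned input cell and the
  scanned work cell; it yields the new state, the symbol written to the work tape, the moves of the
  input head and of the work head, and possibly a letter to be appended to the output.
\<close>

record 'a tm =
  num_states :: nat
  num_symbols :: nat
  start_state :: nat
  halt_state :: nat
  trans :: "nat \<Rightarrow> 'a input_cell \<Rightarrow> nat \<Rightarrow> nat \<times> nat \<times> move \<times> move \<times> 'a option"

definition wf_tm :: "'a tm \<Rightarrow> bool" where
  "wf_tm M \<longleftrightarrow>
     start_state M < num_states M \<and> halt_state M < num_states M \<and> 0 < num_symbols M \<and>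
     (\<forall>q < num_states M. \<forall>a. \<forall>b < num_symbols M.
        case trans M q a b of (q', b', _) \<Rightarrow> q' < num_states M \<and> b' < num_symbols M)"

record 'a config =
  state :: nat
  input_pos :: nat
  work_tape :: "nat \<Rightarrow> nat"
  work_pos :: nat
  written :: "'a list"

definition input_cell :: "'a list \<Rightarrow> nat \<Rightarrow> 'a input_cell" where
  "input_cell x i =
     (if i = 0 then LeftEnd else if i \<le> length x then Letter (x ! (i - 1)) else RightEnd)"

text \<open>Both tapes are bounded on the left: moving left from position 0 has no effect.\<close>

fun move_head :: "move \<Rightarrow> nat \<Rightarrow> nat" where
  "move_head Left i = i - 1"
| "move_head Stay i = i"
| "move_head Right i = i + 1"

definition initial_config :: "'a tm \<Rightarrow> 'a config" where
  "initial_config M =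
     \<lparr>state = start_state M, input_pos = 0, work_tape = (\<lambda>_. 0), work_pos = 0, written = []\<rparr>"

text \<open>The input head is confined to the input and its two end markers.\<close>

definition step :: "'a tm \<Rightarrow> 'a list \<Rightarrow> 'a config \<Rightarrow> 'a config" where
  "step M x c =
     (if state c = halt_state M then c
      else case trans M (state c) (input_cell x (input_pos c)) (work_tape c (work_pos c)) of
        (q, b, mi, mw, w) \<Rightarrow>
          \<lparr>state = q,
           input_pos = min (move_head mi (input_pos c)) (length x + 1),
           work_tape = (work_tape c)(work_pos c := b),
           work_pos = move_head mw (work_pos c),
           written = written c @ (case w of None \<Rightarrow> [] | Some a \<Rightarrow> [a])\<rparr>)"

definition run :: "'a tm \<Rightarrow> 'a list \<Rightarrow> nat \<Rightarrow> 'a config" where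
  "run M x t = (step M x ^^ t) (initial_config M)"

definition tm_output :: "'a tm \<Rightarrow> 'a list \<Rightarrow> 'a list \<Rightarrow> bool" where
  "tm_output M x y \<longleftrightarrow> (\<exists>t. state (run M x t) = halt_state M \<and> written (run M x t) = y)"

text \<open>Only the work tape counts towards the space.\<close>

definition uses_space :: "'a tm \<Rightarrow> 'a list \<Rightarrow> nat \<Rightarrow> bool" where
  "uses_space M x k \<longleftrightarrow> (\<forall>t. work_pos (run M x t) < k)"


section \<open>Log-space computable functions on finite digraphs\<close>

datatype letter = Zero | One | Comma | Semicolon

fun binary :: "nat \<Rightarrow> letter list" where
  "binary n =
     (if n < 2 then [] else binary (n div 2)) @ [if even n then Zero else One]"

declare binary.simps [simp del]

text \<open>
  The list of vertices in increasing order, followed by the list of arcs in lexicographic order;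
  all numbers are written in binary.
\<close>

definition encode_digraph :: "digraph \<Rightarrow> letter list" where
  "encode_digraph G =
     (let vs = sorted_list_of_set (pverts G);
          es = filter (\<lambda>e. e \<in> parcs G) (List.product vs vs)
      in concat (map (\<lambda>v. binary v @ [Comma]) vs) @ [Semicolon] @
         concat (map (\<lambda>(u, v). binary u @ [Comma] @ binary v @ [Semicolon]) es))"

definition logspace_computable :: "(digraph \<Rightarrow> digraph) \<Rightarrow> bool" where
  "logspace_computable F \<longleftrightarrow>
     (\<exists>M s. wf_tm M \<and> (\<lambda>n. real (s n)) \<in> O(\<lambda>n. ln (real n)) \<and>
        (\<forall>G. pair_fin_digraph G \<longrightarrow>
           tm_output M (encode_digraph G) (encode_digraph (F G)) \<and>
           uses_space M (encode_digraph G) (s (length (encode_digraph G)))))"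


section \<open>Promise problems and log-space reductions\<close>

text \<open>A promise problem on finite digraphs: its YES instances and its NO instances.\<close>

type_synonym promise_problem = "digraph set \<times> digraph set"

definition PCSP :: "digraph \<Rightarrow> digraph \<Rightarrow> promise_problem" where
  "PCSP A B = ({I. pair_fin_digraph I \<and> I \<leadsto> A}, {I. pair_fin_digraph I \<and> \<not> I \<leadsto> B})"

definition logspace_reducible :: "promise_problem \<Rightarrow> promise_problem \<Rightarrow> bool" where
  "logspace_reducible P Q \<longleftrightarrow>
     (\<exists>F. fin_digraph_map F \<and> logspace_computable F \<and>
        (\<forall>I \<in> fst P. F I \<in> fst Q) \<and> (\<forall>I \<in> snd P. F I \<in> snd Q))"

definition logspace_equivalent :: "promise_problem \<Rightarrow> promise_problem \<Rightarrow> bool" where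
  "logspace_equivalent P Q \<longleftrightarrow> logspace_reducible P Q \<and> logspace_reducible Q P"

end

theory Submission
  imports Defs
begin

text \<open>
  The reductions are \<open>\<Lambda>\<close> and \<open>\<Gamma>\<close> themselves. For YES instances of the first and NO instances of
  the second, adjointness alone suffices. For the others one uses the unit \<open>I \<leadsto> \<Gamma> (\<Lambda> I)\<close>, which
  turns \<open>\<Lambda> I \<leadsto> \<Omega> G\<close> into \<open>I \<leadsto> \<Gamma> (\<Lambda> I) \<leadsto> G\<close>, and the monotonicity of the right adjoint \<open>\<Gamma>\<close>.
\<close>

lemma hom_to_refl: "G \<leadsto> G"
  unfolding hom_to_def digraph_hom_def by (rule exI[of _ id]) auto

lemma hom_to_trans:
  assumes "A \<leadsto> B" "B \<leadsto> C"
  shows "A \<leadsto> C"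
proof -
  from assms obtain f g where "digraph_hom f A B" "digraph_hom g B C"
    unfolding hom_to_def by blast
  then have "digraph_hom (g \<circ> f) A C"
    unfolding digraph_hom_def by fastforce
  then show ?thesis
    unfolding hom_to_def by blast
qed

lemma adjoint_iff:
  assumes "adjoint L R" "pair_fin_digraph H" "pair_fin_digraph G"
  shows "L H \<leadsto> G \<longleftrightarrow> H \<leadsto> R G"
  using assms unfolding adjoint_def by blast

lemma fin_digraph_mapD: "fin_digraph_map F \<Longrightarrow> pair_fin_digraph G \<Longrightarrow> pair_fin_digraph (F G)"
  unfolding fin_digraph_map_def by blast

text \<open>Transpose the identity on \<open>L H\<close>. Adjointness speaks only of finite
  digraphs, so \<open>L\<close> has to preserve finiteness for \<open>L H\<close> to be an
  admissible target.\<close>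

lemma adjoint_unit:
  assumes "adjoint L R" "fin_digraph_map L" "pair_fin_digraph H"
  shows "H \<leadsto> R (L H)"
  using adjoint_iff[OF assms(1,3) fin_digraph_mapD[OF assms(2,3)]] hom_to_refl by blast

lemma adjoint_counit:
  assumes "adjoint L R" "fin_digraph_map R" "pair_fin_digraph G"
  shows "L (R G) \<leadsto> G"
  using adjoint_iff[OF assms(1) fin_digraph_mapD[OF assms(2,3)] assms(3)] hom_to_refl by blast

text \<open>The counit gives \<open>L (R A) \<leadsto> A \<leadsto> B\<close>; transposing the
  composite yields the claim.\<close>

lemma right_adjoint_mono:
  assumes "adjoint L R" "fin_digraph_map R" "pair_fin_digraph A" "pair_fin_digraph B" "A \<leadsto> B"
  shows "R A \<leadsto> R B"
  using adjoint_iff[OF assms(1) fin_digraph_mapD[OF assms(2,3)] assms(4)]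
    hom_to_trans[OF adjoint_counit[OF assms(1-3)] assms(5)] by blast

theorem theorem4p9:
  fixes \<Gamma> \<Lambda> \<Omega> :: "digraph \<Rightarrow> digraph" and H G :: digraph
  assumes "fin_digraph_map \<Gamma>" and "logspace_computable \<Gamma>"
    and "fin_digraph_map \<Omega>" and "adjoint \<Gamma> \<Omega>"
    and "fin_digraph_map \<Lambda>" and "adjoint \<Lambda> \<Gamma>" and "logspace_computable \<Lambda>"
    and "pair_fin_digraph H" and "pair_fin_digraph G" and "\<Gamma> H \<leadsto> G"
  shows "logspace_equivalent (PCSP (\<Gamma> H) G) (PCSP H (\<Omega> G))"
proof -
  \<comment> \<open>Contrapositive form of: \<open>\<Lambda>\<close> sends NO instances to NO
    instances.\<close>
  have "I \<leadsto> G" if "pair_fin_digraph I" "\<Lambda> I \<leadsto> \<Omega> G" for I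
  proof -
    have "\<Gamma> (\<Lambda> I) \<leadsto> G"
      using adjoint_iff[OF assms(4) fin_digraph_mapD[OF assms(5) that(1)] assms(9)] that(2) by blast
    then show ?thesis
      by (rule hom_to_trans[OF adjoint_unit[OF assms(6,5) that(1)]])
  qed
  moreover have "\<Lambda> I \<leadsto> H" if "pair_fin_digraph I" "I \<leadsto> \<Gamma> H" for I
    using adjoint_iff[OF assms(6) that(1) assms(8)] that(2) by blast
  ultimately have "logspace_reducible (PCSP (\<Gamma> H) G) (PCSP H (\<Omega> G))"
    unfolding logspace_reducible_def PCSP_def
    using assms(5,7) fin_digraph_mapD by (intro exI[of _ \<Lambda>]) auto
  \<comment> \<open>Monotonicity of \<open>\<Gamma>\<close> handles the YES instances; the
    adjunction with \<open>\<Omega>\<close>, negated on both sides, handles the NO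
    instances.\<close>
  moreover have "logspace_reducible (PCSP H (\<Omega> G)) (PCSP (\<Gamma> H) G)"
    unfolding logspace_reducible_def PCSP_def
    using assms(1,2) fin_digraph_mapD right_adjoint_mono[OF assms(6,1) _ assms(8)]
      adjoint_iff[OF assms(4) _ assms(9)]
    by (intro exI[of _ \<Gamma>]) auto
  ultimately show ?thesis
    unfolding logspace_equivalent_def by blast
qed

end
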